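(* Let $A\in\mathbb{R}^{s\times s}$ and $b\in\mathbb{R}^s$ be the coefficients of an explicit Runge--Kutta method, and let $\gamma_1,\gamma_2$ be real numbers with $0\le\gamma_1\le\gamma_2$. Then $$S(A,\gamma_2 b)\subseteq S(A,\gamma_1 b),$$ where $S(A,\gamma b)\subset\mathbb{C}$ denotes the region of absolute stability of the Runge--Kutta method with coefficients $(A,\gamma b)$.
   Context: A method with coefficients $(A,b)$ is explicit if $A$ is strictly lower triangular. Its stability function is $R(z)=1+zb^T(I-zA)^{-1}e$, where $e\in\mathbb{R}^s$ is the vector with all entries equal to $1$. The stability function of $(A,\gamma b)$ is $R_\gamma(z)=1+z\gamma b^T(I-zA)^{-1}e$. The region of absolute stability is $S(A,\gamma b)=\{z\in\mathbb{C}: |R_\gamma(z)|\le 1\}$. *)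

theory Defs
  imports "HOL-Analysis.Analysis"
begin

text \<open>
  The stages of the method are indexed by a finite linearly ordered type \<open>'n\<close>, so that
  \<open>s = CARD('n)\<close>; the order is what gives lower triangularity its meaning.
\<close>

definition explicit_rk :: "real ^ 'n::{finite,linorder} ^ 'n::{finite,linorder} \<Rightarrow> bool" where
  "explicit_rk A \<longleftrightarrow> (\<forall>i j. i \<le> j \<longrightarrow> A $ i $ j = 0)"

definition rk_stage_matrix :: "real ^ 'n ^ 'n \<Rightarrow> complex \<Rightarrow> complex ^ 'n ^ 'n" where
  "rk_stage_matrix A z = mat 1 - map_matrix (\<lambda>a. z * complex_of_real a) A"

text \<open>
  The inverse below is meaningful only where \<open>I - zA\<close> is invertible. For explicit methods this is
  every \<open>z\<close>, see \<open>invertible_rk_stage_matrix\<close>.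
\<close>

definition rk_stability_function :: "real ^ 'n ^ 'n \<Rightarrow> real ^ 'n \<Rightarrow> complex \<Rightarrow> complex" where
  "rk_stability_function A b z =
     1 + z * (\<Sum>i\<in>UNIV. complex_of_real (b $ i) *
                (matrix_inv (rk_stage_matrix A z) *v vec 1) $ i)"

definition rk_stability_region :: "real ^ 'n ^ 'n \<Rightarrow> real ^ 'n \<Rightarrow> complex set" where
  "rk_stability_region A b = {z. cmod (rk_stability_function A b z) \<le> 1}"

lemma invertible_rk_stage_matrix:
  fixes A :: "real ^ 'n::{finite,linorder} ^ 'n::{finite,linorder}"
  assumes "explicit_rk A"
  shows "invertible (rk_stage_matrix A z)"
proof -
  have "x = 0" if x: "rk_stage_matrix A z *v x = 0" for x
  proof (rule ccontr)
    assume "x \<noteq> 0"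
    define N where "N = {i. x $ i \<noteq> 0}"
    have N: "finite N" "N \<noteq> {}"
      using \<open>x \<noteq> 0\<close> by (auto simp: N_def vec_eq_iff)
    define m where "m = Min N"
    have "m \<in> N" using N by (simp add: m_def)
    have zero: "complex_of_real (A $ m $ j) * x $ j = 0" for j
    proof (cases "m \<le> j")
      case True
      then show ?thesis using assms by (simp add: explicit_rk_def)
    next
      case False
      then have "j \<notin> N" using N by (auto simp: m_def)
      then show ?thesis by (simp add: N_def)
    qed
    have "(rk_stage_matrix A z *v x) $ m =
        x $ m - (\<Sum>j\<in>UNIV. z * complex_of_real (A $ m $ j) * x $ j)"
      by (simp add: rk_stage_matrix_def matrix_vector_mult_diff_rdistrib)
         (simp add: matrix_vector_mult_def)
    also have "(\<Sum>j\<in>UNIV. z * complex_of_real (A $ m $ j) * x $ j) = 0"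
      using zero by (intro sum.neutral) (simp add: mult.assoc)
    finally have "x $ m = 0" using x by simp
    with \<open>m \<in> N\<close> show False by (simp add: N_def)
  qed
  then show ?thesis
    unfolding invertible_left_inverse matrix_left_invertible_ker by blast
qed

end

theory Submission
  imports Defs
begin

text \<open>
  For fixed \<open>z\<close> the stability function is affine in the weights, so as \<open>\<gamma>\<close> grows from \<open>0\<close> the
  value \<open>R\<^sub>\<gamma>(z)\<close> moves along a ray that starts at \<open>1\<close>. That starting point lies in the closed unit
  disc, and the disc is convex: the values of \<open>\<gamma> \<ge> 0\<close> for which \<open>R\<^sub>\<gamma>(z)\<close> stays in the disc form
  an interval beginning at \<open>0\<close>, so with \<open>\<gamma>2\<close> it contains every smaller \<open>\<gamma>1 \<ge> 0\<close>.
\<close>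

lemma rk_stability_function_scaleR:
  "rk_stability_function A (\<gamma> *\<^sub>R b) z = 1 + \<gamma> *\<^sub>R (rk_stability_function A b z - 1)"
proof -
  have "complex_of_real ((\<gamma> *\<^sub>R b) $ i) = \<gamma> *\<^sub>R complex_of_real (b $ i)" for i
    by (simp add: scaleR_complex.ctr complex_eq_iff)
  then show ?thesis
    by (simp only: rk_stability_function_def mult_scaleR_left mult_scaleR_right
        scaleR_sum_right[symmetric] add_diff_cancel_left')
qed

text \<open>
  For \<open>t \<noteq> 0\<close> the point with parameter \<open>s\<close> lies the fraction \<open>s / t\<close> of the way from
  \<open>a\<close> to the point with parameter \<open>t\<close>, so it is a convex combination of two points of \<open>C\<close>.
\<close>

lemma convex_ray_mem_mono:
  fixes a w :: "'a::real_vector"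
  assumes "convex C" and "a \<in> C" and "a + t *\<^sub>R w \<in> C" and "0 \<le> s" and "s \<le> t"
  shows "a + s *\<^sub>R w \<in> C"
proof (cases "t = 0")
  case True
  then show ?thesis using assms by simp
next
  case False
  then have "(1 - s / t) *\<^sub>R a + (s / t) *\<^sub>R (a + t *\<^sub>R w) \<in> C"
    using assms by (intro convexD) (auto simp: divide_simps)
  moreover have "(1 - s / t) *\<^sub>R a + (s / t) *\<^sub>R (a + t *\<^sub>R w) = a + s *\<^sub>R w"
    using False by (simp add: algebra_simps)
  ultimately show ?thesis by simp
qed

theorem theorem7:
  fixes A :: "real ^ 'n::{finite,linorder} ^ 'n::{finite,linorder}"
    and b :: "real ^ 'n::{finite,linorder}"
    and \<gamma>1 \<gamma>2 :: real
  assumes "explicit_rk A"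
    and "0 \<le> \<gamma>1"
    and "\<gamma>1 \<le> \<gamma>2"
  shows "rk_stability_region A (\<gamma>2 *\<^sub>R b) \<subseteq> rk_stability_region A (\<gamma>1 *\<^sub>R b)"
proof
  fix z assume "z \<in> rk_stability_region A (\<gamma>2 *\<^sub>R b)"
  then have "1 + \<gamma>2 *\<^sub>R (rk_stability_function A b z - 1) \<in> cball 0 1"
    by (simp add: rk_stability_region_def rk_stability_function_scaleR)
  then have "1 + \<gamma>1 *\<^sub>R (rk_stability_function A b z - 1) \<in> cball 0 1"
    by (rule convex_ray_mem_mono[OF convex_cball _ _ assms(2,3), rotated]) simp
  then show "z \<in> rk_stability_region A (\<gamma>1 *\<^sub>R b)"
    by (simp add: rk_stability_region_def rk_stability_function_scaleR)
qed

end
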